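(* Let $M\ge3$ be an integer and $\chi\in[0,1]$. Suppose that at the wall $\bar y=0$ the moments $\bar f_\alpha$ and $\bar\theta$ satisfy the linearized Maxwell wall boundary conditions described in the context, and that the characteristic variables satisfy $\hat v_-(0)=0$, $\hat v_0(0)=0$ (so that $\hat w_{\rm even}(0)=R_{\rm even}\hat v_+(0)$ and $\hat w_{\rm odd}(0)=R_{\rm odd}\hat v_+(0)$). Then $\hat v_+(0)$ and $\bar\theta(0)$ satisfy the following $m_o+1$ boundary conditions: $$\bar q_2\,c_r+E\begin{bmatrix}0& \\ &M_0\end{bmatrix}\begin{bmatrix}\bar\theta(0)-\bar\theta^W \\ \hat w_{\rm odd}(0)\end{bmatrix}=b(\chi)\,E\,T\begin{bmatrix}\bar\theta(0)-\bar\theta^W \\ \hat w_{\rm even}(0)\end{bmatrix}.$$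
   Context: Moments and wall conditions. $e_1,e_2,e_3$ is the standard basis of $\mathbb{R}^3$. The unknowns are real values (at $\bar y=0$) $\bar f_\alpha$, $\alpha\in\mathbb{N}^3$, $|\alpha|\le M$ (with $\bar f_0=\bar\rho$), $\bar\theta$, and $\bar u_1,\bar u_2,\bar u_3$, subject to $\bar f_{e_i}=0$, $\sum_{d=1}^3\bar f_{2e_d}=0$, $\bar u_2=0$; $\bar q_2=3\bar f_{3e_2}+\bar f_{2e_1+e_2}+\bar f_{2e_3+e_2}$. Wall data: $\bar\theta^W$, $\bar u^W_i$ with $\bar u^W_2=0$, and a real number $\bar\rho^W$. Put $\bar m_0=\bar\rho^W$, $\bar m_{e_i}=\bar u_i^W-\bar u_i$, $\bar m_{2e_i}=\frac12(\bar\theta^W-\bar\theta)$, and $\bar m_\alpha=0$ for all other $\alpha$. Let $b(\chi)=\frac{2\chi}{2-\chi}(2\pi)^{-1/2}$, let $\mathrm{He}_n$ be the probabilists' Hermite polynomials and $S(\alpha,\beta)=\int_{-\infty}^0\xi\,\mathrm{He}_\alpha(\xi)\mathrm{He}_\beta(\xi)e^{-\xi^2/2}d\xi$. The linearized wall boundary conditions are: for every $\alpha\in\mathbb{N}^3$ with $|\alpha|\le M-1$ and $\alpha_2$ even, $$\alpha_2!\big(\bar f_{\alpha-e_2}+(\alpha_2+1)\bar f_{\alpha+e_2}\big)=b(\chi)\sum_{\substack{0\le\beta\le M-\alpha_1-\alpha_3 \\ \beta\ \text{even}}}S(\alpha_2,\beta)\big(\bar f_{(\alpha_1,\beta,\alpha_3)}-\bar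 m_{(\alpha_1,\beta,\alpha_3)}\big),$$ where $\bar f_\alpha=0$ if $\alpha$ has a negative component. In the case $\chi=0$ one has $b(\chi)=0$. If $\chi>0$, the condition with $\alpha=0$ determines $\bar\rho^W$. Reduced unknowns. $\bar g_i=\bar f_{2e_1+ie_2}+\bar f_{2e_3+ie_2}$, $\bar t_i=\bar f_{(i+2)e_2}$, $m_o=2\lfloor\frac{M-1}2\rfloor-1$, $m_e=2\lfloor\frac M2\rfloor-1$, $\hat f_{\rm even}=(\bar t_0,\bar t_2,\bar g_2,\dots,\bar t_{m_e-1},\bar g_{m_e-1})^T\in\mathbb{R}^{m_e}$, $\hat f_{\rm odd}=(\bar t_1-\frac{\bar q_2}5,\bar t_3,\bar g_3,\dots,\bar t_{m_o},\bar g_{m_o})^T\in\mathbb{R}^{m_o}$, $\hat w_{\rm even}=L_1\hat f_{\rm even}$, $\hat w_{\rm odd}=L_2\hat f_{\rm odd}$. Matrices. $\mathrm{He}_\alpha(\xi)=\prod_i\mathrm{He}_{\alpha_i}(\xi_i)$, $\bar\omega(\xi)=(2\pi)^{-3/2}e^{-|\xi|^2/2}$, $\langle p,q\rangle_{\bar\omega}=\int_{\mathbb{R}^3}pq\,\bar\omega\,d\xi$. $\phi_1=\mathrm{He}_{2e_2}-\frac12(\mathrm{He}_{2e_1}+\mathrm{He}_{2e_3})$, $\phi_{2k}=\mathrm{He}_{(2k+2)e_2}$, $\phi_{2k+1}=\frac12(\mathrm{He}_{2e_1+2ke_2}+\mathrm{He}_{2e_3+2ke_2})$ for $1\le k\le(m_e-1)/2$;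 $\varphi_1=\mathrm{He}_{3e_2}-\frac32(\mathrm{He}_{2e_1+e_2}+\mathrm{He}_{2e_3+e_2})$, $\varphi_{2k}=\mathrm{He}_{(2k+3)e_2}$, $\varphi_{2k+1}=\frac12(\mathrm{He}_{2e_1+(2k+1)e_2}+\mathrm{He}_{2e_3+(2k+1)e_2})$ for $1\le k\le(m_o-1)/2$. $a_i=\sqrt{\langle\phi_i,\phi_i\rangle_{\bar\omega}}$, $b_j=\sqrt{\langle\varphi_j,\varphi_j\rangle_{\bar\omega}}$, $L_1=\mathrm{diag}(a_i)$, $L_2=\mathrm{diag}(b_j)$, $M_0=(m^0_{ij})\in\mathbb{R}^{m_e\times m_o}$, $m^0_{ij}=\frac1{a_ib_j}\langle\phi_i,\xi_2\varphi_j\rangle_{\bar\omega}$. Characteristic variables. Fix an orthogonal diagonalization $\mathbf M R=R\Lambda$ of $\mathbf M=\begin{bmatrix}0&M_0 \\ M_0^T&0\end{bmatrix}$ with $R=\begin{bmatrix}R_{\rm even}&R_0&R_{\rm even} \\ R_{\rm odd}&0&-R_{\rm odd}\end{bmatrix}$ orthogonal, $R_{\rm even}\in\mathbb{R}^{m_e\times m_o}$, $R_{\rm odd}\in\mathbb{R}^{m_o\times m_o}$, $\Lambda=\mathrm{diag}(\Lambda_+,0_{m_e-m_o},-\Lambda_+)$, $\Lambda_+$ positive diagonal. Put $(\hat v_+,\hat v_0,\hat v_-)^T=R^{-1}(\hat w_{\rm even},\hat w_{\rm odd})^T$ with $\hat v_\pm\in\mathbb{R}^{m_o}$, $\hat v_0\in\mathbb{R}^{m_e-m_o}$.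 Boundary matrices. $T^b=(t^b_{ij})\in\mathbb{R}^{(m_e+1)\times(m_e+1)}$ with nonzero entries only for $i\equiv j\pmod2$: $t^b_{2k,2l}=S(2k-2,2l-2)$, $t^b_{2k-1,2l-1}=S(2k,2l)-\frac{S(2k,0)}{S(0,0)}S(0,2l)$, $k,l\ge1$. $P_1=\begin{bmatrix}0.5&1 \\ 1&-1\end{bmatrix}$, $$T=\begin{bmatrix}1& \\ &L_1^{-1}\end{bmatrix}\begin{bmatrix}P_1& \\ &I_{m_e-1}\end{bmatrix}T^b\begin{bmatrix}P_1& \\ &I_{m_e-1}\end{bmatrix}\begin{bmatrix}1& \\ &L_1^{-1}\end{bmatrix}.$$ $E=[I_{m_o+1},0]\in\mathbb{R}^{(m_o+1)\times(m_e+1)}$; $\begin{bmatrix}0& \\ &M_0\end{bmatrix}$ is block diagonal of size $(m_e+1)\times(m_o+1)$; $c_r=(1,\frac4{5\sqrt3},\frac{2\sqrt6}5,\frac{2\sqrt2}5,0,\dots,0)^T\in\mathbb{R}^{m_o+1}$ (truncated to its first two entries if $M=3$). *)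

theory Defs
  imports "HOL-Analysis.Analysis" "Jordan_Normal_Form.Gauss_Jordan_Elimination"
begin

hide_const (open) Finite_Cartesian_Product.vec Cartesian_Space.vector

(* Multi-indices (a1, a2, a3) and points of R^3 are triples.  The type
   real * real * real carries the Euclidean norm, and lborel on it is
   three-dimensional Lebesgue measure.
   Vectors and matrices are those of Jordan_Normal_Form, hence 0-based; all
   families of entries below keep the usual 1-based numbering, and the shift
   happens only where a vec or mat is formed. *)

(* Probabilists' convention: leading coefficient 1, orthogonal for exp (-x^2/2). *)
fun He :: "nat \<Rightarrow> real \<Rightarrow> real" where
  "He 0 x = 1"
| "He (Suc 0) x = x"
| "He (Suc (Suc n)) x = x * He (Suc n) x - real (Suc n) * He n x"

definition He3 :: "nat \<times> nat \<times> nat \<Rightarrow> real \<times> real \<times> real \<Rightarrow> real" where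
  "He3 = (\<lambda>(a1, a2, a3) (x1, x2, x3). He a1 x1 * He a2 x2 * He a3 x3)"

(* The boundary integral S(a, b) over the half-line of negative velocities. *)
definition half_moment :: "nat \<Rightarrow> nat \<Rightarrow> real" where
  "half_moment a b = (LBINT x:{..0}. x * He a x * He b x * exp (- x\<^sup>2 / 2))"

definition maxwellian :: "real \<times> real \<times> real \<Rightarrow> real" where
  "maxwellian \<xi> = (2 * pi) powr (- 3 / 2) * exp (- (norm \<xi>)\<^sup>2 / 2)"

definition weighted_inner ::
  "(real \<times> real \<times> real \<Rightarrow> real) \<Rightarrow> (real \<times> real \<times> real \<Rightarrow> real) \<Rightarrow> real" where
  "weighted_inner p q = (\<integral>\<xi>. p \<xi> * q \<xi> * maxwellian \<xi> \<partial>lborel)"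

definition bcoef :: "real \<Rightarrow> real" where
  "bcoef chi = 2 * chi / (2 - chi) * (2 * pi) powr (- 1 / 2)"

(* u and uW are read at the indices 1, 2, 3 only, and f at multi-indices of
   order at most M only. *)

definition wall_moment ::
  "real \<Rightarrow> (nat \<Rightarrow> real) \<Rightarrow> (nat \<Rightarrow> real) \<Rightarrow> real \<Rightarrow> real \<Rightarrow> nat \<times> nat \<times> nat \<Rightarrow> real" where
  "wall_moment \<rho>W uW u \<theta>W \<theta> \<alpha> =
    (if \<alpha> = (0, 0, 0) then \<rho>W
     else if \<alpha> = (1, 0, 0) then uW 1 - u 1
     else if \<alpha> = (0, 1, 0) then uW 2 - u 2
     else if \<alpha> = (0, 0, 1) then uW 3 - u 3
     else if \<alpha> \<in> {(2, 0, 0), (0, 2, 0), (0, 0, 2)} then (\<theta>W - \<theta>) / 2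
     else 0)"

definition linearized_wall_bc ::
  "nat \<Rightarrow> real \<Rightarrow> (nat \<times> nat \<times> nat \<Rightarrow> real) \<Rightarrow> (nat \<Rightarrow> real) \<Rightarrow> real \<Rightarrow>
   real \<Rightarrow> (nat \<Rightarrow> real) \<Rightarrow> real \<Rightarrow> bool" where
  "linearized_wall_bc M chi f u \<theta> \<rho>W uW \<theta>W \<longleftrightarrow>
    (\<forall>a1 a2 a3. a1 + a2 + a3 \<le> M - 1 \<and> even a2 \<longrightarrow>
      fact a2 * ((if a2 = 0 then 0 else f (a1, a2 - 1, a3))
                 + real (a2 + 1) * f (a1, a2 + 1, a3))
      = bcoef chi * (\<Sum>\<beta> \<in> {\<beta>. \<beta> \<le> M - a1 - a3 \<and> even \<beta>}. half_moment a2 \<beta> *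
          (f (a1, \<beta>, a3) - wall_moment \<rho>W uW u \<theta>W \<theta> (a1, \<beta>, a3))))"

definition heat_flux2 :: "(nat \<times> nat \<times> nat \<Rightarrow> real) \<Rightarrow> real" where
  "heat_flux2 f = 3 * f (0, 3, 0) + f (2, 1, 0) + f (0, 1, 2)"

definition gbar :: "(nat \<times> nat \<times> nat \<Rightarrow> real) \<Rightarrow> nat \<Rightarrow> real" where
  "gbar f i = f (2, i, 0) + f (0, i, 2)"

definition tbar :: "(nat \<times> nat \<times> nat \<Rightarrow> real) \<Rightarrow> nat \<Rightarrow> real" where
  "tbar f i = f (0, i + 2, 0)"

(* Positive, and free of truncation, for M at least 3. *)
definition m_odd :: "nat \<Rightarrow> nat" where
  "m_odd M = 2 * ((M - 1) div 2) - 1"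

definition m_even :: "nat \<Rightarrow> nat" where
  "m_even M = 2 * (M div 2) - 1"

definition f_even_entry :: "(nat \<times> nat \<times> nat \<Rightarrow> real) \<Rightarrow> nat \<Rightarrow> real" where
  "f_even_entry f i =
    (if i = 1 then tbar f 0 else if even i then tbar f i else gbar f (i - 1))"

definition f_odd_entry :: "(nat \<times> nat \<times> nat \<Rightarrow> real) \<Rightarrow> nat \<Rightarrow> real" where
  "f_odd_entry f i =
    (if i = 1 then tbar f 1 - heat_flux2 f / 5
     else if even i then tbar f (i + 1) else gbar f i)"

definition f_even :: "nat \<Rightarrow> (nat \<times> nat \<times> nat \<Rightarrow> real) \<Rightarrow> real vec" where
  "f_even M f = vec (m_even M) (\<lambda>i. f_even_entry f (i + 1))"

definition f_odd :: "nat \<Rightarrow> (nat \<times> nat \<times> nat \<Rightarrow> real) \<Rightarrow> real vec" where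
  "f_odd M f = vec (m_odd M) (\<lambda>i. f_odd_entry f (i + 1))"

(* Unspecified for singular A, where mat_inverse is None. *)
definition mat_inv :: "real mat \<Rightarrow> real mat" where
  "mat_inv A = the (mat_inverse A)"

definition append_cols :: "real mat \<Rightarrow> real mat \<Rightarrow> real mat" (infixr \<open>@\<^sub>c\<close> 65) where
  "A @\<^sub>c B = four_block_mat A B (0\<^sub>m 0 (dim_col A)) (0\<^sub>m 0 (dim_col B))"

definition phi_even :: "nat \<Rightarrow> real \<times> real \<times> real \<Rightarrow> real" where
  "phi_even i \<xi> =
    (if i = 1 then He3 (0, 2, 0) \<xi> - (He3 (2, 0, 0) \<xi> + He3 (0, 0, 2) \<xi>) / 2
     else if even i then He3 (0, i + 2, 0) \<xi>
     else (He3 (2, i - 1, 0) \<xi> + He3 (0, i - 1, 2) \<xi>) / 2)"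

definition phi_odd :: "nat \<Rightarrow> real \<times> real \<times> real \<Rightarrow> real" where
  "phi_odd j \<xi> =
    (if j = 1 then He3 (0, 3, 0) \<xi> - 3 / 2 * (He3 (2, 1, 0) \<xi> + He3 (0, 1, 2) \<xi>)
     else if even j then He3 (0, j + 3, 0) \<xi>
     else (He3 (2, j, 0) \<xi> + He3 (0, j, 2) \<xi>) / 2)"

definition a_norm :: "nat \<Rightarrow> real" where
  "a_norm i = sqrt (weighted_inner (phi_even i) (phi_even i))"

definition b_norm :: "nat \<Rightarrow> real" where
  "b_norm j = sqrt (weighted_inner (phi_odd j) (phi_odd j))"

definition L1 :: "nat \<Rightarrow> real mat" where
  "L1 M = mat_diag (m_even M) (\<lambda>i. a_norm (i + 1))"

definition L2 :: "nat \<Rightarrow> real mat" where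
  "L2 M = mat_diag (m_odd M) (\<lambda>j. b_norm (j + 1))"

definition m0_entry :: "nat \<Rightarrow> nat \<Rightarrow> real" where
  "m0_entry i j = 1 / (a_norm i * b_norm j) *
     weighted_inner (phi_even i) (\<lambda>(x1, x2, x3). x2 * phi_odd j (x1, x2, x3))"

definition M0 :: "nat \<Rightarrow> real mat" where
  "M0 M = mat (m_even M) (m_odd M) (\<lambda>(i, j). m0_entry (i + 1) (j + 1))"

definition system_mat :: "nat \<Rightarrow> real mat" where
  "system_mat M = four_block_mat (0\<^sub>m (m_even M) (m_even M)) (M0 M)
                                 (transpose_mat (M0 M)) (0\<^sub>m (m_odd M) (m_odd M))"

definition w_even :: "nat \<Rightarrow> (nat \<times> nat \<times> nat \<Rightarrow> real) \<Rightarrow> real vec" where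
  "w_even M f = L1 M *\<^sub>v f_even M f"

definition w_odd :: "nat \<Rightarrow> (nat \<times> nat \<times> nat \<Rightarrow> real) \<Rightarrow> real vec" where
  "w_odd M f = L2 M *\<^sub>v f_odd M f"

definition eigvec_mat :: "nat \<Rightarrow> real mat \<Rightarrow> real mat \<Rightarrow> real mat \<Rightarrow> real mat" where
  "eigvec_mat M Reven R0 Rodd =
     (Reven @\<^sub>c R0 @\<^sub>c Reven) @\<^sub>r (Rodd @\<^sub>c 0\<^sub>m (m_odd M) (m_even M - m_odd M) @\<^sub>c - Rodd)"

definition eigval_mat :: "nat \<Rightarrow> real mat \<Rightarrow> real mat" where
  "eigval_mat M \<Lambda>p =
     diag_block_mat [\<Lambda>p, 0\<^sub>m (m_even M - m_odd M) (m_even M - m_odd M), - \<Lambda>p]"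

(* Orthogonality is spelled out: orthogonal_mat of Jordan_Normal_Form does not
   require columns of unit length. *)
definition orthogonal_diagonalization ::
  "nat \<Rightarrow> real mat \<Rightarrow> real mat \<Rightarrow> real mat \<Rightarrow> real mat \<Rightarrow> bool" where
  "orthogonal_diagonalization M Reven R0 Rodd \<Lambda>p \<longleftrightarrow>
    (let R = eigvec_mat M Reven R0 Rodd in
      Reven \<in> carrier_mat (m_even M) (m_odd M) \<and>
      R0 \<in> carrier_mat (m_even M) (m_even M - m_odd M) \<and>
      Rodd \<in> carrier_mat (m_odd M) (m_odd M) \<and>
      \<Lambda>p \<in> carrier_mat (m_odd M) (m_odd M) \<and>
      diagonal_mat \<Lambda>p \<and> (\<forall>i < m_odd M. 0 < \<Lambda>p $$ (i, i)) \<and>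
      inverts_mat R (transpose_mat R) \<and> inverts_mat (transpose_mat R) R \<and>
      system_mat M * R = R * eigval_mat M \<Lambda>p)"

definition tb_entry :: "nat \<Rightarrow> nat \<Rightarrow> real" where
  "tb_entry i j =
    (if even i \<and> even j then half_moment (i - 2) (j - 2)
     else if odd i \<and> odd j then
       half_moment (i + 1) (j + 1)
       - half_moment (i + 1) 0 / half_moment 0 0 * half_moment 0 (j + 1)
     else 0)"

definition Tb :: "nat \<Rightarrow> real mat" where
  "Tb M = mat (m_even M + 1) (m_even M + 1) (\<lambda>(i, j). tb_entry (i + 1) (j + 1))"

definition P1 :: "real mat" where
  "P1 = mat_of_rows_list 2 [[1 / 2, 1], [1, - 1]]"

definition T_mat :: "nat \<Rightarrow> real mat" where
  "T_mat M =
    (let D = diag_block_mat [1\<^sub>m 1, mat_inv (L1 M)];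
         P = diag_block_mat [P1, 1\<^sub>m (m_even M - 1)]
     in D * P * Tb M * P * D)"

definition E_mat :: "nat \<Rightarrow> real mat" where
  "E_mat M = 1\<^sub>m (m_odd M + 1) @\<^sub>c 0\<^sub>m (m_odd M + 1) (m_even M - m_odd M)"

(* The entries beyond the second one disappear when m_odd M = 1, i.e. for M = 3
   and also for M = 4. *)
definition c_r :: "nat \<Rightarrow> real vec" where
  "c_r M = vec (m_odd M + 1) (\<lambda>i.
     if i = 0 then 1
     else if i = 1 then 4 / (5 * sqrt 3)
     else if i = 2 then 2 * sqrt 6 / 5
     else if i = 3 then 2 * sqrt 2 / 5
     else 0)"

end

theory Submission
  imports "HOL-Probability.Distributions" Defs
begin

unbundle no vec_syntax

text \<open>Orthogonality of the Hermite polynomials makes every row of \<open>M\<^sub>0 L\<^sub>2\<close> explicit with at most two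
  nonzero entries, reflecting the recursion \<open>x He\<^sub>n = He\<^sub>n\<^sub>+\<^sub>1 + n He\<^sub>n\<^sub>-\<^sub>1\<close>, and so reproduces the left-hand
  sides of the wall conditions for \<open>\<alpha> = 2k e\<^sub>2\<close> and of the sum of those for \<open>\<alpha> = 2e\<^sub>1 + 2k e\<^sub>2\<close> and
  \<open>\<alpha> = 2e\<^sub>3 + 2k e\<^sub>2\<close>. Only the first entry of \<open>f\<^sub>o\<^sub>d\<^sub>d\<close> is not a moment but \<open>t\<^sub>1 - q\<^sub>2/5\<close>, with
  \<open>g\<^sub>1 = q\<^sub>2 - 3 t\<^sub>1\<close>; the multiples of \<open>q\<^sub>2\<close> left over in the rows it touches are the entries of \<open>c\<^sub>r\<close>.
  On the right-hand side the condition for \<open>\<alpha> = 0\<close> eliminates \<open>f\<^sub>0 - \<rho>\<^sup>W\<close> and the trace condition gives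
  \<open>g\<^sub>0 = - t\<^sub>0\<close>, which is what \<open>P\<^sub>1\<close> encodes.\<close>

subsection \<open>Hermite orthogonality\<close>

text \<open>The recursion trades a degree of \<open>He\<close> for a factor \<open>x\<close>, so the
  induction has to carry an arbitrary power \<open>k\<close>.\<close>

lemma integrable_power_mult_He:
  "integrable lborel (\<lambda>x. std_normal_density x * (x ^ k * He n x))"
proof (induction n arbitrary: k rule: induct_nat_012)
  case 0
  show ?case using integrable_std_normal_moment[of k] by simp
next
  case 1
  show ?case using integrable_std_normal_moment[of "Suc k"] by (simp add: mult_ac)
next
  case (ge2 n)
  have "integrable lborel (\<lambda>x. std_normal_density x * (x ^ Suc k * He (Suc n) x)
          - real (Suc n) * (std_normal_density x * (x ^ k * He n x)))"
    by (rule Bochner_Integration.integrable_diff[OF ge2(2) integrable_mult_right[OF ge2(1)]])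
  then show ?case
    by (rule back_subst[where P = "integrable lborel"]) (simp add: fun_eq_iff algebra_simps)
qed

definition power_He_moment :: "nat \<Rightarrow> nat \<Rightarrow> real" where
  "power_He_moment k n = (\<integral>x. std_normal_density x * (x ^ k * He n x) \<partial>lborel)"

lemma power_He_moment_Suc_Suc:
  "power_He_moment k (Suc (Suc n)) =
    power_He_moment (Suc k) (Suc n) - real (Suc n) * power_He_moment k n"
proof -
  have "power_He_moment k (Suc (Suc n)) =
    (\<integral>x. std_normal_density x * (x ^ Suc k * He (Suc n) x)
        - real (Suc n) * (std_normal_density x * (x ^ k * He n x)) \<partial>lborel)"
    unfolding power_He_moment_def by (rule Bochner_Integration.integral_cong) (simp_all add: algebra_simps)
  then show ?thesis
    unfolding power_He_moment_def
    by (subst (asm) Bochner_Integration.integral_diff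
          [OF integrable_power_mult_He integrable_mult_right[OF integrable_power_mult_He]]) simp
qed

lemma power_He_moment_0_0: "power_He_moment 0 0 = 1"
  using integral_std_normal_moment_even[of 0] by (simp add: power_He_moment_def)

lemma power_He_moment_1:
  "power_He_moment k (Suc 0) = power_He_moment (Suc k) 0"
  by (simp add: power_He_moment_def mult_ac)

text \<open>For even \<open>k\<close> both sides vanish; for odd \<open>k\<close> the closed forms
  of consecutive even moments have ratio \<open>k\<close>.\<close>

lemma power_He_moment_Suc_0:
  "power_He_moment (Suc k) 0 = real k * power_He_moment (k - 1) 0"
proof (cases "even k")
  case True
  then obtain i where k: "k = 2 * i" by blast
  have "power_He_moment (2 * i + 1) 0 = 0" for i
    using integral_std_normal_moment_odd[of i] by (simp add: power_He_moment_def)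
  from this[of i] this[of "i - 1"] show ?thesis
    by (cases i) (simp_all add: k)
next
  case False
  then obtain i where k: "k = 2 * i + 1" by (rule oddE)
  have even: "power_He_moment (2 * i) 0 = fact (2 * i) / (2 ^ i * fact i)" for i
    using integral_std_normal_moment_even[of i] by (simp add: power_He_moment_def)
  have "power_He_moment (Suc k) 0 = fact (2 * Suc i) / (2 ^ Suc i * fact (Suc i))"
    using even[of "Suc i"] by (simp add: k del: fact_Suc power_Suc)
  also have "\<dots> = (2 * real i + 2) * ((2 * real i + 1) * fact (2 * i)) / ((2 * real i + 2) * (2 ^ i * fact i))"
    by (simp add: algebra_simps)
  also have "\<dots> = (2 * real i + 1) * fact (2 * i) / (2 ^ i * fact i)"
    by (rule mult_divide_mult_cancel_left) simp
  also have "\<dots> = real k * power_He_moment (k - 1) 0"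
    by (simp add: k even)
  finally show ?thesis .
qed

text \<open>Gaussian integration by parts; on polynomials it is a consequence of the moment recursion.\<close>
lemma power_He_moment_Suc:
  "power_He_moment k (Suc n) = real k * power_He_moment (k - 1) n"
proof (induction n arbitrary: k rule: less_induct)
  case (less n)
  show ?case
  proof (cases n)
    case 0
    then show ?thesis by (simp add: power_He_moment_1 power_He_moment_Suc_0)
  next
    case n: (Suc m)
    \<comment> \<open>Both sides of the goal reduce to the real number \<open>k - m\<close> times
      \<open>power_He_moment k m\<close>. This uses the induction hypothesis at the higher exponent
      \<open>k + 1\<close>.\<close>
    have rec: "power_He_moment (Suc k) (Suc m) = real (Suc k) * power_He_moment k m"
      using less[of m "Suc k"] n by simp
    show ?thesis
    proof (cases m)
      case m0: 0
      show ?thesis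
      proof (cases k)
        case 0
        then show ?thesis using rec by (simp add: n m0 power_He_moment_Suc_Suc)
      next
        case (Suc j)
        have "power_He_moment j (Suc 0) = power_He_moment k 0"
          by (simp add: power_He_moment_1 Suc)
        then show ?thesis using rec
          by (simp add: n m0 power_He_moment_Suc_Suc Suc algebra_simps)
      qed
    next
      case m: (Suc l)
      have IH: "power_He_moment k m = real k * power_He_moment (k - 1) l"
        using less[of l k] n m by simp
      have "real k * power_He_moment (k - 1) n =
          real k * power_He_moment k m - real m * power_He_moment k m"
      proof (cases k)
        case 0
        then show ?thesis using IH by simp
      next
        case k: (Suc j)
        have j: "power_He_moment j n = power_He_moment k m - real m * power_He_moment j l"
          by (simp add: n m k power_He_moment_Suc_Suc)
        have "real k * power_He_moment j n
            = real k * power_He_moment k m - real m * (real k * power_He_moment j l)"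
          by (simp add: j right_diff_distrib mult.left_commute)
        then show ?thesis
          using IH by (simp add: k)
      qed
      then show ?thesis
        using rec by (simp add: n power_He_moment_Suc_Suc algebra_simps)
    qed
  qed
qed

lemma power_He_moment_0: "power_He_moment 0 n = (if n = 0 then 1 else 0)"
  by (cases n) (simp_all add: power_He_moment_0_0 power_He_moment_Suc)

lemma integrable_power_mult_He_He:
  "integrable lborel (\<lambda>x. std_normal_density x * (x ^ k * He m x * He n x))"
proof (induction m arbitrary: k rule: induct_nat_012)
  case 0
  show ?case using integrable_power_mult_He[of k] by simp
next
  case 1
  show ?case using integrable_power_mult_He[of "Suc k"] by (simp add: mult_ac)
next
  case (ge2 m)
  have "integrable lborel (\<lambda>x. std_normal_density x * (x ^ Suc k * He (Suc m) x * He n x)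
          - real (Suc m) * (std_normal_density x * (x ^ k * He m x * He n x)))"
    by (rule Bochner_Integration.integrable_diff[OF ge2(2) integrable_mult_right[OF ge2(1)]])
  then show ?case
    by (rule back_subst[where P = "integrable lborel"]) (simp add: fun_eq_iff algebra_simps)
qed

lemma integrable_He_He: "integrable lborel (\<lambda>x. std_normal_density x * (He m x * He n x))"
  using integrable_power_mult_He_He[of 0] by simp

lemma mult_He: "x * He n x = He (Suc n) x + real n * He (n - 1) x"
  by (cases n) simp_all

text \<open>Multiplication by \<open>x\<close> is symmetric: expanding it on either factor gives a
  recursion for the row \<open>m + 1\<close> in terms of the rows \<open>m\<close> and
  \<open>m - 1\<close>, and row 0 consists of the Gaussian means of the \<open>He n\<close>.\<close>

lemma He_orthogonal:
  "(\<integral>x. std_normal_density x * (He m x * He n x) \<partial>lborel) = (if m = n then fact m else 0)"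
proof -
  define G where "G m n = (\<integral>x. std_normal_density x * (He m x * He n x) \<partial>lborel)" for m n
  have G0: "G 0 n = (if n = 0 then 1 else 0)" for n
    using power_He_moment_0[of n] by (simp add: G_def power_He_moment_def)
  have shift: "(\<integral>x. std_normal_density x * (x * He m x * He n x) \<partial>lborel)
      = G (Suc m) n + real m * G (m - 1) n" for m n
  proof -
    have "(\<integral>x. std_normal_density x * (x * He m x * He n x) \<partial>lborel) =
      (\<integral>x. std_normal_density x * (He (Suc m) x * He n x)
          + real m * (std_normal_density x * (He (m - 1) x * He n x)) \<partial>lborel)"
      unfolding mult_He by (rule Bochner_Integration.integral_cong) (simp_all add: algebra_simps)
    then show ?thesis
      unfolding G_def
      by (subst (asm) Bochner_Integration.integral_add)
         (auto intro!: integrable_mult_right integrable_He_He)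
  qed
  have rec: "G (Suc m) n = G m (Suc n) + real n * G m (n - 1) - real m * G (m - 1) n" for m n
  proof -
    have comm: "G m n = G n m" for m n by (simp add: G_def mult_ac)
    show ?thesis
      using shift[of m n] shift[of n m] by (simp add: comm[of _ m] mult_ac)
  qed
  have "\<forall>n. G m n = (if m = n then fact m else 0)"
  proof (induction m rule: less_induct)
    case (less m)
    show ?case
    proof (cases m)
      case 0
      then show ?thesis by (simp add: G0)
    next
      case m: (Suc k)
      have IH: "G k n = (if k = n then fact k else 0)" for n
        using less m by simp
      \<comment> \<open>The factor \<open>k\<close> makes the truncated index \<open>k - 1\<close>
        harmless and turns (k - 1)! into k!.\<close>
      have IH': "real k * G (k - 1) n = (if k = Suc n then fact k else 0)" for n
        using less m by (cases k) auto
      show ?thesis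
        unfolding m rec IH IH' by (auto simp: fact_reduce)
    qed
  qed
  then show ?thesis by (simp add: G_def)
qed

section \<open>Three-dimensional Gaussian integrals and the first half-line moment\<close>

lemma maxwellian_Pair:
  "maxwellian (x, y, z) = std_normal_density x * (std_normal_density y * std_normal_density z)"
proof -
  have "(2 * pi) powr (- 3 / 2) = (1 / sqrt (2 * pi)) ^ 3"
    by (simp add: powr_minus_divide powr_half_sqrt[symmetric] powr_power power_one_over)
  moreover have "(norm (x, y, z))\<^sup>2 = x\<^sup>2 + (y\<^sup>2 + z\<^sup>2)"
    by (simp add: norm_Pair)
  then have "exp (- (norm (x, y, z))\<^sup>2 / 2)
      = exp (- x\<^sup>2 / 2) * (exp (- y\<^sup>2 / 2) * exp (- z\<^sup>2 / 2))"
    by (simp add: field_simps flip: exp_add)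
  ultimately show ?thesis
    by (simp add: maxwellian_def std_normal_density_def power3_eq_cube)
qed

text \<open>Fubini for a product; two applications reduce integrals over triples to one-dimensional
  ones, with integrability carried along.\<close>

lemma has_bochner_integral_pair_mult:
  fixes f g :: "_ \<Rightarrow> real"
  assumes f: "has_bochner_integral lborel f a" and g: "has_bochner_integral lborel g b"
  shows "has_bochner_integral lborel (\<lambda>(x, y). f x * g y) (a * b)"
proof -
  have [measurable]: "f \<in> borel_measurable lborel" "g \<in> borel_measurable lborel"
    using f g by (auto dest: has_bochner_integral_integrable)
  have int: "integrable (lborel \<Otimes>\<^sub>M lborel) (\<lambda>(x, y). f x * g y)"
    using f g unfolding has_bochner_integral_iff
    by (intro lborel_pair.Fubini_integrable) (auto simp: abs_mult)
  moreover have "(\<integral>z. (case z of (x, y) \<Rightarrow> f x * g y) \<partial>(lborel \<Otimes>\<^sub>M lborel)) = a * b"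
    using f g lborel_pair.integral_fst[OF int] by (simp add: has_bochner_integral_iff)
  ultimately show ?thesis
    by (simp add: has_bochner_integral_iff lborel_prod)
qed

lemma has_bochner_integral_He3_He3:
  "has_bochner_integral lborel (\<lambda>\<xi>. He3 (a, b, c) \<xi> * He3 (a', b', c') \<xi> * maxwellian \<xi>)
     (if (a, b, c) = (a', b', c') then fact a * fact b * fact c else 0)"
proof -
  have He: "has_bochner_integral lborel (\<lambda>x. std_normal_density x * (He m x * He n x))
      (if m = n then fact m else 0)" for m n
    by (simp add: has_bochner_integral_iff integrable_He_He He_orthogonal)
  have 1: "(\<lambda>\<xi>. He3 (a, b, c) \<xi> * He3 (a', b', c') \<xi> * maxwellian \<xi>) =
      (\<lambda>(x, yz). std_normal_density x * (He a x * He a' x) *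
        (case yz of (y, z) \<Rightarrow> std_normal_density y * (He b y * He b' y) *
          (std_normal_density z * (He c z * He c' z))))"
    by (auto simp: fun_eq_iff He3_def maxwellian_Pair)
  have 2: "(if (a, b, c) = (a', b', c') then fact a * fact b * fact c else 0) =
      (if a = a' then fact a else 0) *
      ((if b = b' then fact b else 0) * (if c = c' then fact c else 0 :: real))"
    by simp
  show ?thesis
    unfolding 1 2 by (intro has_bochner_integral_pair_mult He)
qed

text \<open>The substitution x = - sqrt 2 * t leads to the integral of t * exp (- t^2) over the
  positive half-line, which is 1/2. The nonzero value serves as pivot when the density jump is
  eliminated.\<close>

lemma half_moment_0_0: "half_moment 0 0 = - 1"
proof -
  let ?f = "\<lambda>x::real. indicator {..0} x * (x * exp (- x\<^sup>2 / 2))"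
  have "has_bochner_integral lborel (\<lambda>x::real. - sqrt 2 * (indicator {0..} x * (exp (- x\<^sup>2) * x))) (- sqrt 2 * (1 / 2))"
    using has_bochner_integral_mult_right[OF gaussian_moment_1, of "- sqrt 2"] by simp
  moreover have "(\<lambda>x::real. - sqrt 2 * (indicator {0..} x * (exp (- x\<^sup>2) * x))) = (\<lambda>x. ?f (0 + (- sqrt 2) * x))"
    by (auto simp: fun_eq_iff indicator_def power_mult_distrib zero_le_mult_iff)
  moreover have "- sqrt 2 * (1 / 2) = - 1 /\<^sub>R \<bar>- sqrt 2\<bar>"
    by (simp add: field_simps)
  ultimately have "has_bochner_integral lborel (\<lambda>x. ?f (0 + (- sqrt 2) * x)) (- 1 /\<^sub>R \<bar>- sqrt 2\<bar>)"
    by (simp only:)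
  then have "has_bochner_integral lborel ?f (- 1)"
    by (subst lborel_has_bochner_integral_real_affine_iff[of "- sqrt 2" _ _ 0]) simp_all
  then show ?thesis
    by (simp add: half_moment_def set_lebesgue_integral_def has_bochner_integral_iff mult_ac)
qed

subsection \<open>Inner products of the basis functions\<close>

text \<open>Listing coefficients with multi-indices turns inner products of the basis functions into
  finite computations for the simplifier.\<close>

definition hermite_comb :: "(real \<times> nat \<times> nat \<times> nat) list \<Rightarrow> real \<times> real \<times> real \<Rightarrow> real" where
  "hermite_comb xs \<xi> = (\<Sum>(c, \<alpha>)\<leftarrow>xs. c * He3 \<alpha> \<xi>)"

definition He3_inner :: "nat \<times> nat \<times> nat \<Rightarrow> nat \<times> nat \<times> nat \<Rightarrow> real" where
  "He3_inner \<alpha> \<beta> = (case \<alpha> of (a, b, c) \<Rightarrow> if \<alpha> = \<beta> then fact a * fact b * fact c else 0)"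

lemma weighted_inner_hermite_comb:
  "weighted_inner (hermite_comb xs) (hermite_comb ys)
    = (\<Sum>(c, \<alpha>)\<leftarrow>xs. c * (\<Sum>(d, \<beta>)\<leftarrow>ys. d * He3_inner \<alpha> \<beta>))"
proof -
  have 1: "has_bochner_integral lborel (\<lambda>\<xi>. He3 \<alpha> \<xi> * He3 \<beta> \<xi> * maxwellian \<xi>) (He3_inner \<alpha> \<beta>)"
    for \<alpha> \<beta>
    using has_bochner_integral_He3_He3 by (cases \<alpha>; cases \<beta>) (simp add: He3_inner_def)
  have 2: "has_bochner_integral lborel (\<lambda>\<xi>. He3 \<alpha> \<xi> * hermite_comb ys \<xi> * maxwellian \<xi>)
      (\<Sum>(d, \<beta>)\<leftarrow>ys. d * He3_inner \<alpha> \<beta>)" for \<alpha>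
  proof (induction ys)
    case (Cons y ys)
    obtain d \<beta> where "y = (d, \<beta>)" by (cases y)
    then show ?case
      using has_bochner_integral_add[OF has_bochner_integral_mult_right[OF 1, of d \<alpha> \<beta>] Cons]
      by (simp add: hermite_comb_def algebra_simps)
  qed (simp add: hermite_comb_def has_bochner_integral_zero)
  have "has_bochner_integral lborel (\<lambda>\<xi>. hermite_comb xs \<xi> * hermite_comb ys \<xi> * maxwellian \<xi>)
      (\<Sum>(c, \<alpha>)\<leftarrow>xs. c * (\<Sum>(d, \<beta>)\<leftarrow>ys. d * He3_inner \<alpha> \<beta>))"
  proof (induction xs)
    case (Cons x xs)
    obtain c \<alpha> where "x = (c, \<alpha>)" by (cases x)
    then show ?case
      using has_bochner_integral_add[OF has_bochner_integral_mult_right[OF 2, of c \<alpha>] Cons]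
      by (simp add: hermite_comb_def algebra_simps)
  qed (simp add: hermite_comb_def has_bochner_integral_zero)
  then show ?thesis
    unfolding weighted_inner_def
    by (simp add: has_bochner_integral_iff)
qed

text \<open>Multiplication by the second coordinate on the list level, via x He_n = He_(n+1) + n
  He_(n-1). At \<open>a2 = 0\<close> the truncated index comes with coefficient 0.\<close>

definition raise2 :: "(real \<times> nat \<times> nat \<times> nat) list \<Rightarrow> (real \<times> nat \<times> nat \<times> nat) list" where
  "raise2 xs = concat (map (\<lambda>(c, a1, a2, a3).
     [(c, a1, Suc a2, a3), (c * real a2, a1, a2 - 1, a3)]) xs)"

lemma hermite_comb_raise2:
  "(\<lambda>(x1, x2, x3). x2 * hermite_comb xs (x1, x2, x3)) = hermite_comb (raise2 xs)"
proof
  fix \<xi> :: "real \<times> real \<times> real"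
  obtain x1 x2 x3 where \<xi>: "\<xi> = (x1, x2, x3)" by (cases \<xi>)
  have "x2 * hermite_comb xs (x1, x2, x3) = hermite_comb (raise2 xs) (x1, x2, x3)"
  proof (induction xs)
    case (Cons y xs)
    obtain c a1 a2 a3 where y: "y = (c, a1, a2, a3)" by (cases y)
    have "x2 * He3 (a1, a2, a3) (x1, x2, x3) = He a1 x1 * (x2 * He a2 x2) * He a3 x3"
      by (simp add: He3_def)
    then show ?case
      using Cons unfolding mult_He
      by (simp add: hermite_comb_def raise2_def y He3_def algebra_simps)
  qed (simp add: hermite_comb_def raise2_def)
  then show "(case \<xi> of (x1, x2, x3) \<Rightarrow> x2 * hermite_comb xs (x1, x2, x3)) = hermite_comb (raise2 xs) \<xi>"
    by (simp add: \<xi>)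
qed

lemma phi_even_hermite_comb:
  "phi_even i = hermite_comb
    (if i = 1 then [(1, 0, 2, 0), (- 1 / 2, 2, 0, 0), (- 1 / 2, 0, 0, 2)]
     else if even i then [(1, 0, i + 2, 0)]
     else [(1 / 2, 2, i - 1, 0), (1 / 2, 0, i - 1, 2)])"
  by (auto simp: fun_eq_iff phi_even_def hermite_comb_def field_simps)

lemma phi_odd_hermite_comb:
  "phi_odd j = hermite_comb
    (if j = 1 then [(1, 0, 3, 0), (- 3 / 2, 2, 1, 0), (- 3 / 2, 0, 1, 2)]
     else if even j then [(1, 0, j + 3, 0)]
     else [(1 / 2, 2, j, 0), (1 / 2, 0, j, 2)])"
  by (auto simp: fun_eq_iff phi_odd_def hermite_comb_def field_simps)

lemma weighted_inner_phi_even: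
  "weighted_inner (phi_even i) (phi_even i)
    = (if i = 1 then 3 else if even i then fact (i + 2) else fact (i - 1))"
  unfolding phi_even_hermite_comb weighted_inner_hermite_comb
  by (simp add: He3_inner_def)

lemma a_norm_pos: "0 < a_norm i"
  unfolding a_norm_def weighted_inner_phi_even by simp

lemma b_norm_pos: "0 < b_norm j"
  unfolding b_norm_def phi_odd_hermite_comb weighted_inner_hermite_comb
  by (simp add: He3_inner_def numeral_3_eq_3)

text \<open>The entries of \<open>M0\<close> before normalization. The factors \<open>b_norm\<close>
  cancel against \<open>L2\<close>, so a row of \<open>M0\<close> applied to \<open>w_odd\<close>
  involves only these numbers and one \<open>a_norm\<close>.\<close>

definition coupling :: "nat \<Rightarrow> nat \<Rightarrow> real" where
  "coupling i j = weighted_inner (phi_even i) (\<lambda>(x1, x2, x3). x2 * phi_odd j (x1, x2, x3))"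

lemmas coupling_expand = coupling_def phi_even_hermite_comb phi_odd_hermite_comb hermite_comb_raise2
  weighted_inner_hermite_comb

text \<open>The value 9 is 3 * 2! from \<open>He3 (0, 2, 0)\<close> plus (3/4) * 2! from each of
  \<open>He3 (2, 0, 0)\<close> and \<open>He3 (0, 0, 2)\<close>. For \<open>j > 1\<close> no term of
  total degree 2 arises.\<close>

lemma coupling_1: "j \<ge> 1 \<Longrightarrow> coupling 1 j = (if j = 1 then 9 else 0)"
  unfolding coupling_expand
  by (auto simp: He3_inner_def raise2_def numeral_2_eq_2 fact_numeral)

text \<open>Column \<open>2 * k\<close> contributes through lowering, column
  \<open>2 * k - 2\<close> through raising. For \<open>k = 1\<close> the latter would be 0; column
  1, which contains \<open>He3 (0, 3, 0)\<close>, takes its place.\<close>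

lemma coupling_even:
  assumes "k \<ge> 1" "j \<ge> 1"
  shows "coupling (2 * k) j = (if j = 2 * k then (2 * real k + 3) * fact (2 * k + 2) else 0)
    + (if j = (if k = 1 then 1 else 2 * k - 2) then fact (2 * k + 2) else 0)"
proof (cases "even j")
  case True
  then obtain l where "j = 2 * l" by blast
  with assms show ?thesis
    unfolding coupling_expand
    by (cases "k = Suc l"; cases "k = l") (auto simp: He3_inner_def raise2_def)
next
  case False
  with assms show ?thesis
    unfolding coupling_expand by (auto simp: He3_inner_def raise2_def fact_numeral)
qed

text \<open>Again one lowering and one raising term. The exception - 6 = 2 * (1/2) * (- 3/2) * 2! *
  2! stems from the coefficient - 3/2 in \<open>phi_odd 1\<close>.\<close>

lemma coupling_odd:
  assumes "k \<ge> 1" "j \<ge> 1"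
  shows "coupling (2 * k + 1) j = (if j = 2 * k + 1 then fact (2 * k + 1) else 0)
    + (if j = 2 * k - 1 then (if k = 1 then - 6 else fact (2 * k)) else 0)"
proof (cases "even j")
  case True
  with assms show ?thesis
    unfolding coupling_expand by (auto simp: He3_inner_def raise2_def)
next
  case False
  then obtain l where "j = 2 * l + 1" by (rule oddE)
  with assms show ?thesis
    unfolding coupling_expand by (auto simp: He3_inner_def raise2_def)
qed

subsection \<open>Block matrices\<close>

lemma mult_mat_vec_zero: "A *\<^sub>v 0\<^sub>v (dim_col A) = (0\<^sub>v (dim_row A) :: 'a :: semiring_0 vec)"
  by (rule eq_vecI) (simp_all add: scalar_prod_def)

lemma zero_mat_mult_vec: "v \<in> carrier_vec m \<Longrightarrow> 0\<^sub>m n m *\<^sub>v v = (0\<^sub>v n :: 'a :: semiring_0 vec)"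
  by (rule eq_vecI) (simp_all add: scalar_prod_def)

lemma mat_diag_mult_vec:
  fixes v :: "'a :: semiring_0 vec"
  assumes "v \<in> carrier_vec n"
  shows "mat_diag n g *\<^sub>v v = vec n (\<lambda>i. g i * v $ i)"
proof (rule eq_vecI)
  fix i assume "i < dim_vec (vec n (\<lambda>i. g i * v $ i))"
  then have i: "i < n" by simp
  have "(mat_diag n g *\<^sub>v v) $ i = (\<Sum>j = 0..<n. (if i = j then g j else 0) * v $ j)"
    using assms i unfolding mat_diag_def by (simp add: scalar_prod_def)
  also have "\<dots> = (\<Sum>j = 0..<n. if i = j then g i * v $ i else 0)"
    by (intro sum.cong) auto
  also have "\<dots> = g i * v $ i"
    using i by simp
  finally show "(mat_diag n g *\<^sub>v v) $ i = vec n (\<lambda>i. g i * v $ i) $ i"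
    using i by simp
qed (simp add: mat_diag_def)

lemma append_cols_mult_vec:
  assumes A: "A \<in> carrier_mat n m1" and B: "B \<in> carrier_mat n m2"
    and u: "u \<in> carrier_vec m1" and v: "v \<in> carrier_vec m2"
  shows "(A @\<^sub>c B) *\<^sub>v (u @\<^sub>v v) = A *\<^sub>v u + B *\<^sub>v v"
proof -
  have "(A @\<^sub>c B) *\<^sub>v (u @\<^sub>v v) = (A *\<^sub>v u + B *\<^sub>v v) @\<^sub>v (0\<^sub>m 0 m1 *\<^sub>v u + 0\<^sub>m 0 m2 *\<^sub>v v)"
    using A B u v unfolding append_cols_def
    by (subst four_block_mat_mult_vec[of _ n m1 _ m2 _ 0]) auto
  also have "\<dots> = A *\<^sub>v u + B *\<^sub>v v"
    using A B by (intro eq_vecI) auto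
  finally show ?thesis .
qed

lemma append_cols_carrier:
  assumes "A \<in> carrier_mat n m1" "B \<in> carrier_mat n m2"
  shows "A @\<^sub>c B \<in> carrier_mat n (m1 + m2)"
  using assms unfolding append_cols_def carrier_mat_def by auto

lemma diag_block_mat_mult_vec:
  assumes A: "A \<in> carrier_mat n1 m1" and B: "B \<in> carrier_mat n2 m2"
    and u: "u \<in> carrier_vec m1" and v: "v \<in> carrier_vec m2"
  shows "diag_block_mat [A, B] *\<^sub>v (u @\<^sub>v v) = (A *\<^sub>v u) @\<^sub>v (B *\<^sub>v v :: 'a :: comm_ring_1 vec)"
proof -
  have "diag_block_mat [A, B] = four_block_mat A (0\<^sub>m n1 m2) (0\<^sub>m n2 m1) B"
    using A B by (simp add: diag_block_mat.simps(2)[of A "[B]"] Let_def del: diag_block_mat.simps)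
  then show ?thesis
    using A B u v
    by (simp add: four_block_mat_mult_vec[of A n1 m1 _ m2 _ n2] zero_mat_mult_vec)
qed

lemma diag_block_mat_carrier:
  assumes "A \<in> carrier_mat n1 m1" "B \<in> carrier_mat n2 m2"
  shows "diag_block_mat [A, B] \<in> carrier_mat (n1 + n2) (m1 + m2)"
  using assms by auto

lemma diag_block_mat_mult_vCons:
  assumes A: "A \<in> carrier_mat 1 1" and B: "B \<in> carrier_mat n m" and v: "v \<in> carrier_vec m"
  shows "diag_block_mat [A, B] *\<^sub>v vCons a v = vCons (A $$ (0, 0) * a) (B *\<^sub>v v :: 'a :: comm_ring_1 vec)"
proof -
  have "A *\<^sub>v vCons a vNil = vCons (A $$ (0, 0) * a) vNil"
    using A by (intro eq_vecI) (auto simp: scalar_prod_def)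
  moreover have "vCons a vNil \<in> carrier_vec 1"
    by (intro carrier_vecI) simp
  ultimately show ?thesis
    using diag_block_mat_mult_vec[OF A B _ v, of "vCons a vNil"] by simp
qed

text \<open>A two-sided inverse rules out \<open>None\<close>, where \<open>mat_inv\<close> is
  unspecified; the rest is uniqueness of inverses.\<close>

lemma mat_inv_eqI:
  assumes A: "A \<in> carrier_mat n n" and B: "B \<in> carrier_mat n n"
    and AB: "A * B = 1\<^sub>m n" and BA: "B * A = 1\<^sub>m n"
  shows "mat_inv A = B"
proof (cases "mat_inverse A")
  case None
  have "A \<in> Units (ring_mat TYPE(real) n ())"
    using assms by (auto simp: Units_def ring_mat_def)
  with mat_inverse(1)[OF A None, of "()"] show ?thesis by contradiction
next
  case (Some C)
  with mat_inverse(2)[OF A] have C: "A * C = 1\<^sub>m n" "C \<in> carrier_mat n n" by auto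
  have "C = (B * A) * C" using C BA by simp
  also have "\<dots> = B" using A B C by (simp add: assoc_mult_mat[of _ n n _ n])
  finally show ?thesis by (simp add: mat_inv_def Some)
qed

lemma mat_inv_L1: "mat_inv (L1 M) = mat_diag (m_even M) (\<lambda>i. 1 / a_norm (i + 1))"
proof -
  have "a_norm i \<noteq> 0" for i
    using a_norm_pos[of i] by simp
  then show ?thesis
    unfolding L1_def by (intro mat_inv_eqI) simp_all
qed

section \<open>Action of the eigenvector matrix, of E and of the factors of T\<close>

lemma eigvec_mat_carrier:
  assumes "Reven \<in> carrier_mat (m_even M) (m_odd M)"
    "R0 \<in> carrier_mat (m_even M) (m_even M - m_odd M)"
    "Rodd \<in> carrier_mat (m_odd M) (m_odd M)"
  shows "eigvec_mat M Reven R0 Rodd \<in>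
    carrier_mat (m_even M + m_odd M) (m_odd M + (m_even M - m_odd M + m_odd M))"
  unfolding eigvec_mat_def
  by (intro carrier_append_rows append_cols_carrier) (use assms in auto)

text \<open>Makes the subtraction \<open>m_even M - m_odd M\<close> exact, so that the eigenvector
  matrix is square.\<close>

lemma m_odd_le_m_even: "m_odd M \<le> m_even M"
  by (simp add: m_odd_def m_even_def div_le_mono diff_le_mono)

text \<open>Only the first block column acts once the other two blocks of characteristic variables
  vanish.\<close>

lemma eigvec_mat_mult_vec:
  assumes R: "Reven \<in> carrier_mat (m_even M) (m_odd M)"
    "R0 \<in> carrier_mat (m_even M) (m_even M - m_odd M)"
    "Rodd \<in> carrier_mat (m_odd M) (m_odd M)"
    and v: "v \<in> carrier_vec (m_odd M)"
  shows "eigvec_mat M Reven R0 Rodd *\<^sub>v (v @\<^sub>v 0\<^sub>v (m_even M - m_odd M) @\<^sub>v 0\<^sub>v (m_odd M))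
    = (Reven *\<^sub>v v) @\<^sub>v (Rodd *\<^sub>v v)"
proof -
  let ?p = "m_even M" and ?q = "m_odd M" and ?d = "m_even M - m_odd M"
  let ?Z = "0\<^sub>m ?q ?d :: real mat"
  have cols: "R0 @\<^sub>c Reven \<in> carrier_mat ?p (?d + ?q)" "?Z @\<^sub>c - Rodd \<in> carrier_mat ?q (?d + ?q)"
    by (intro append_cols_carrier; use R in simp)+
  have "(Reven @\<^sub>c R0 @\<^sub>c Reven) *\<^sub>v (v @\<^sub>v 0\<^sub>v ?d @\<^sub>v 0\<^sub>v ?q) = Reven *\<^sub>v v + (R0 *\<^sub>v 0\<^sub>v ?d + Reven *\<^sub>v 0\<^sub>v ?q)"
    using R v cols
    by (simp add: append_cols_mult_vec[of _ ?p ?q _ "?d + ?q"] append_cols_mult_vec[of _ ?p ?d _ ?q])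
  also have "\<dots> = Reven *\<^sub>v v"
    using R v mult_mat_vec_zero[of R0] mult_mat_vec_zero[of Reven] by (simp add: carrier_matD)
  finally have 1: "(Reven @\<^sub>c R0 @\<^sub>c Reven) *\<^sub>v (v @\<^sub>v 0\<^sub>v ?d @\<^sub>v 0\<^sub>v ?q) = Reven *\<^sub>v v" .
  have "(Rodd @\<^sub>c ?Z @\<^sub>c - Rodd) *\<^sub>v (v @\<^sub>v 0\<^sub>v ?d @\<^sub>v 0\<^sub>v ?q) = Rodd *\<^sub>v v + (?Z *\<^sub>v 0\<^sub>v ?d + (- Rodd) *\<^sub>v 0\<^sub>v ?q)"
    using R v cols
    by (simp add: append_cols_mult_vec[of _ ?q ?q _ "?d + ?q"] append_cols_mult_vec[of _ ?q ?d _ ?q])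
  also have "\<dots> = Rodd *\<^sub>v v"
    using R v mult_mat_vec_zero[of "- Rodd"] by (simp add: carrier_matD zero_mat_mult_vec)
  finally have 2: "(Rodd @\<^sub>c ?Z @\<^sub>c - Rodd) *\<^sub>v (v @\<^sub>v 0\<^sub>v ?d @\<^sub>v 0\<^sub>v ?q) = Rodd *\<^sub>v v" .
  show ?thesis
    unfolding eigvec_mat_def
    by (subst mat_mult_append[OF append_cols_carrier[OF R(1) cols(1)] append_cols_carrier[OF R(3) cols(2)]])
       (use v in \<open>simp_all add: 1 2\<close>)
qed

lemma E_mat_mult_vec:
  assumes v: "v \<in> carrier_vec (m_even M + 1)"
  shows "E_mat M *\<^sub>v v = vec (m_odd M + 1) (\<lambda>i. v $ i)"
proof -
  let ?q = "m_odd M + 1" and ?d = "m_even M - m_odd M"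
  have "v \<in> carrier_vec (?q + ?d)"
    using v m_odd_le_m_even[of M] by simp
  then have "E_mat M *\<^sub>v v = E_mat M *\<^sub>v (vec_first v ?q @\<^sub>v vec_last v ?d)"
    by simp
  also have "\<dots> = vec_first v ?q"
    unfolding E_mat_def
    by (simp add: append_cols_mult_vec[of _ ?q ?q _ ?d] zero_mat_mult_vec)
  finally show ?thesis
    by (simp add: vec_first_def)
qed

text \<open>Formulated for an arbitrary entry function \<open>x\<close>, so that a chain of factors
  is evaluated by rewriting entry functions.\<close>

lemma P1_block_mult_vec:
  "diag_block_mat [P1, 1\<^sub>m n] *\<^sub>v vec (n + 2) x
    = vec (n + 2) (\<lambda>i. if i = 0 then x 0 / 2 + x 1 else if i = 1 then x 0 - x 1 else x i)"
proof -
  let ?u = "vCons (x 0) (vCons (x 1) vNil)" and ?v = "vec n (\<lambda>i. x (i + 2))"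
  have u: "?u \<in> carrier_vec 2"
    by (intro carrier_vecI) simp
  have P1: "P1 \<in> carrier_mat 2 2"
    by (intro carrier_matI) (simp_all add: P1_def mat_of_rows_list_def)
  have "vec (n + 2) x = ?u @\<^sub>v ?v"
    by (rule eq_vecI) (auto simp: vec_index_vCons intro!: arg_cong[of _ _ x])
  then have "diag_block_mat [P1, 1\<^sub>m n] *\<^sub>v vec (n + 2) x = (P1 *\<^sub>v ?u) @\<^sub>v ?v"
    using diag_block_mat_mult_vec[OF P1 _ u, of "1\<^sub>m n" n n ?v] by simp
  also have "P1 *\<^sub>v ?u = vCons (x 0 / 2 + x 1) (vCons (x 0 - x 1) vNil)"
    by (rule eq_vecI)
       (auto simp: P1_def mat_of_rows_list_def scalar_prod_def numeral_2_eq_2 vec_index_vCons less_Suc_eq)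
  finally show ?thesis
    by (auto simp: vec_index_vCons intro!: eq_vecI arg_cong[of _ _ x])
qed

lemma L1_inv_block_mult_vec:
  "diag_block_mat [1\<^sub>m 1, mat_inv (L1 M)] *\<^sub>v vec (m_even M + 1) x
    = vec (m_even M + 1) (\<lambda>i. if i = 0 then x 0 else x i / a_norm i)"
proof -
  have "vec (m_even M + 1) x = vCons (x 0) (vec (m_even M) (\<lambda>i. x (i + 1)))"
    by (rule eq_vecI) (auto simp: vec_index_vCons)
  moreover have "diag_block_mat [1\<^sub>m 1, mat_inv (L1 M)] *\<^sub>v vCons (x 0) (vec (m_even M) (\<lambda>i. x (i + 1)))
    = vCons (1\<^sub>m 1 $$ (0, 0) * x 0) (mat_inv (L1 M) *\<^sub>v vec (m_even M) (\<lambda>i. x (i + 1)))"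
    by (rule diag_block_mat_mult_vCons[of _ _ "m_even M" "m_even M"]) (simp_all add: mat_inv_L1)
  ultimately show ?thesis
    by (auto simp: mat_inv_L1 mat_diag_mult_vec vec_index_vCons intro!: eq_vecI)
qed

lemma assoc_mult_mat_vec_palindrome:
  assumes A: "A \<in> carrier_mat n n" and B: "B \<in> carrier_mat n n" and C: "C \<in> carrier_mat n n"
    and v: "v \<in> carrier_vec n"
  shows "A * B * C * B * A *\<^sub>v v = A *\<^sub>v (B *\<^sub>v (C *\<^sub>v (B *\<^sub>v (A *\<^sub>v v))))"
proof -
  note carriers = A B C v mult_carrier_mat[of _ n n _ n] mult_mat_vec_carrier[of _ n n]
  have "A * B * C * B * A *\<^sub>v v = A * B * C * B *\<^sub>v (A *\<^sub>v v)"
    by (intro assoc_mult_mat_vec[of _ n n _ n] carriers)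
  also have "\<dots> = A * B * C *\<^sub>v (B *\<^sub>v (A *\<^sub>v v))"
    by (intro assoc_mult_mat_vec[of _ n n _ n] carriers)
  also have "\<dots> = A * B *\<^sub>v (C *\<^sub>v (B *\<^sub>v (A *\<^sub>v v)))"
    by (intro assoc_mult_mat_vec[of _ n n _ n] carriers)
  also have "\<dots> = A *\<^sub>v (B *\<^sub>v (C *\<^sub>v (B *\<^sub>v (A *\<^sub>v v))))"
    by (intro assoc_mult_mat_vec[of _ n n _ n] carriers)
  finally show ?thesis .
qed

subsection \<open>Wall conditions\<close>

text \<open>The 0-based entries of the vector \<open>(\<theta> - \<theta>\<^sup>W, f\<^sub>e\<^sub>v\<^sub>e\<^sub>n)\<close> after the multiplication by \<open>P\<^sub>1\<close>; they are the
  combinations of \<open>f - m\<close> on the right-hand sides of the wall conditions.\<close>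
definition wall_jump :: "(nat \<times> nat \<times> nat \<Rightarrow> real) \<Rightarrow> real \<Rightarrow> nat \<Rightarrow> real" where
  "wall_jump f d j =
    (if even j then tbar f j + (if j = 0 then d / 2 else 0)
     else gbar f (j - 1) + (if j = 1 then d else 0))"

definition Tb_wall_jump :: "nat \<Rightarrow> (nat \<times> nat \<times> nat \<Rightarrow> real) \<Rightarrow> real \<Rightarrow> nat \<Rightarrow> real" where
  "Tb_wall_jump M f d i = (\<Sum>j<m_even M + 1. tb_entry (i + 1) (j + 1) * wall_jump f d j)"

lemma T_mat_mult_vec:
  fixes d :: real
  assumes M: "3 \<le> M" and trace: "f (2, 0, 0) + f (0, 2, 0) + f (0, 0, 2) = 0"
  defines "y \<equiv> Tb_wall_jump M f d"
  shows "T_mat M *\<^sub>v vCons d (w_even M f) = vec (m_even M + 1)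
    (\<lambda>i. if i = 0 then y 0 / 2 + y 1 else if i = 1 then (y 0 - y 1) / a_norm 1 else y i / a_norm i)"
proof -
  let ?n = "m_even M + 1"
  let ?D = "diag_block_mat [1\<^sub>m 1, mat_inv (L1 M)]"
    and ?P = "diag_block_mat [P1, 1\<^sub>m (m_even M - 1)]"
  have "m_even M \<ge> 1"
    using M by (simp add: m_even_def)
  then have n: "?n = m_even M - 1 + 2"
    by simp
  have D: "?D \<in> carrier_mat ?n ?n"
    using diag_block_mat_carrier[of "1\<^sub>m 1" 1 1 "mat_inv (L1 M)" "m_even M" "m_even M"]
    by (simp add: mat_inv_L1 del: diag_block_mat.simps)
  have "P1 \<in> carrier_mat 2 2"
    by (intro carrier_matI) (simp_all add: P1_def mat_of_rows_list_def)
  then have P: "?P \<in> carrier_mat ?n ?n"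
    using diag_block_mat_carrier[of P1 2 2 "1\<^sub>m (m_even M - 1)" "m_even M - 1" "m_even M - 1"] n
    by (simp del: diag_block_mat.simps)
  have Tb: "Tb M \<in> carrier_mat ?n ?n"
    by (simp add: Tb_def)
  have a: "a_norm i \<noteq> 0" for i
    using a_norm_pos[of i] by simp
  \<comment> \<open>The temperature jump occupies position 0, so the 0-based position
    \<open>i\<close> carries the 1-based entry \<open>i\<close>.\<close>
  have w: "vCons d (w_even M f) = vec ?n (\<lambda>i. if i = 0 then d else a_norm i * f_even_entry f i)"
    unfolding w_even_def L1_def f_even_def
    by (rule eq_vecI) (auto simp: mat_diag_mult_vec vec_index_vCons)
  have Dw: "?D *\<^sub>v vCons d (w_even M f) = vec ?n (\<lambda>i. if i = 0 then d else f_even_entry f i)"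
    unfolding w L1_inv_block_mult_vec by (rule eq_vecI) (auto simp: a)
  \<comment> \<open>The second row of \<open>P1\<close> yields \<open>d - tbar f 0\<close>, which
    thereby becomes the entry \<open>gbar f 0 + d\<close> of \<open>wall_jump\<close>.\<close>
  have "gbar f 0 = - tbar f 0"
    using trace by (simp add: gbar_def tbar_def numeral_2_eq_2)
  then have PDw: "?P *\<^sub>v (?D *\<^sub>v vCons d (w_even M f)) = vec ?n (wall_jump f d)"
    unfolding Dw unfolding n P1_block_mult_vec
    by (intro eq_vecI) (auto simp: wall_jump_def f_even_entry_def)
  have TPDw: "Tb M *\<^sub>v (?P *\<^sub>v (?D *\<^sub>v vCons d (w_even M f))) = vec ?n y"
    unfolding PDw Tb_def y_def Tb_wall_jump_def
    by (rule eq_vecI) (simp_all add: scalar_prod_def lessThan_atLeast0)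
  have "T_mat M *\<^sub>v vCons d (w_even M f)
      = ?D *\<^sub>v (?P *\<^sub>v (Tb M *\<^sub>v (?P *\<^sub>v (?D *\<^sub>v vCons d (w_even M f)))))"
    unfolding T_mat_def Let_def w by (rule assoc_mult_mat_vec_palindrome[OF D P Tb]) simp
  also have "\<dots> = ?D *\<^sub>v vec ?n (\<lambda>i. if i = 0 then y 0 / 2 + y 1 else if i = 1 then y 0 - y 1 else y i)"
    unfolding TPDw unfolding n P1_block_mult_vec ..
  finally show ?thesis
    unfolding L1_inv_block_mult_vec by (auto intro!: eq_vecI)
qed

section \<open>Wall conditions as rows of the boundary matrix\<close>

lemma sum_even_le: "(\<Sum>\<beta> \<in> {\<beta>. \<beta> \<le> n \<and> even \<beta>}. F \<beta>) = (\<Sum>l\<le>n div 2. F (2 * l))"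
  for F :: "nat \<Rightarrow> 'a :: comm_monoid_add"
  by (rule sum.reindex_bij_witness[of _ "\<lambda>l. 2 * l" "\<lambda>\<beta>. \<beta> div 2"]) auto

lemma sum_lessThan_double:
  "(\<Sum>j<2 * n. F j) = (\<Sum>l<n. F (2 * l)) + (\<Sum>l<n. F (2 * l + 1))"
  for F :: "nat \<Rightarrow> 'a :: comm_monoid_add"
  by (induction n) (simp_all add: algebra_simps)

lemma Suc_m_even: "3 \<le> M \<Longrightarrow> m_even M + 1 = 2 * (M div 2)"
  by (simp add: m_even_def)

text \<open>The 0-based position \<open>2 * k\<close> has the odd number \<open>2 * k + 1\<close> in
  \<open>tb_entry\<close>, which selects the branch with the correction; entries of mixed parity
  vanish.\<close>

lemma Tb_wall_jump_even:
  assumes "3 \<le> M"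
  shows "Tb_wall_jump M f d (2 * k) = (\<Sum>l<M div 2.
    (half_moment (2 * k + 2) (2 * l + 2)
      - half_moment (2 * k + 2) 0 / half_moment 0 0 * half_moment 0 (2 * l + 2)) * wall_jump f d (2 * l))"
  unfolding Tb_wall_jump_def Suc_m_even[OF assms] sum_lessThan_double
  by (simp add: tb_entry_def)

lemma Tb_wall_jump_odd:
  assumes "3 \<le> M"
  shows "Tb_wall_jump M f d (2 * k + 1)
    = (\<Sum>l<M div 2. half_moment (2 * k) (2 * l) * wall_jump f d (2 * l + 1))"
  unfolding Tb_wall_jump_def Suc_m_even[OF assms] sum_lessThan_double
  by (simp add: tb_entry_def)

text \<open>The condition with \<open>\<alpha> = 0\<close> eliminates \<open>f\<^sub>0 - \<rho>\<^sup>W\<close>, whence the Schur-complement form of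
  the odd-numbered entries of \<open>Tb\<close>.\<close>
lemma wall_bc_tbar:
  assumes M: "3 \<le> M" and f2: "f (0, 1, 0) = 0"
    and bc: "linearized_wall_bc M chi f u \<theta> \<rho>W uW \<theta>W"
    and k: "2 * k + 2 \<le> M - 1"
  shows "fact (2 * k + 2) * (f (0, 2 * k + 1, 0) + (2 * real k + 3) * f (0, 2 * k + 3, 0))
    = bcoef chi * Tb_wall_jump M f (\<theta> - \<theta>W) (2 * k)"
proof -
  let ?x = "wall_jump f (\<theta> - \<theta>W)"
  define N where "N = M div 2"
  define h where "h l = f (0, 2 * l, 0) - wall_moment \<rho>W uW u \<theta>W \<theta> (0, 2 * l, 0)" for l
  have h: "h (Suc l) = ?x (2 * l)" for l
    by (auto simp: h_def wall_jump_def wall_moment_def tbar_def field_simps)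
  have rhs: "(\<Sum>\<beta> \<in> {\<beta>. \<beta> \<le> M - 0 - 0 \<and> even \<beta>}. half_moment n \<beta> *
          (f (0, \<beta>, 0) - wall_moment \<rho>W uW u \<theta>W \<theta> (0, \<beta>, 0)))
      = half_moment n 0 * h 0 + (\<Sum>l<N. half_moment n (2 * l + 2) * ?x (2 * l))" for n
  proof -
    have "(\<Sum>\<beta> \<in> {\<beta>. \<beta> \<le> M - 0 - 0 \<and> even \<beta>}. half_moment n \<beta> *
          (f (0, \<beta>, 0) - wall_moment \<rho>W uW u \<theta>W \<theta> (0, \<beta>, 0)))
        = (\<Sum>l<Suc N. half_moment n (2 * l) * h l)"
      unfolding sum_even_le by (simp add: h_def N_def lessThan_Suc_atMost)
    then show ?thesis
      by (simp add: sum.lessThan_Suc_shift h del: sum.lessThan_Suc)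
  qed
  \<comment> \<open>For \<alpha> = 0 the left-hand side of the wall condition is
    \<open>f (0, 1, 0)\<close>, which is 0.\<close>
  have "0 = bcoef chi * (half_moment 0 0 * h 0 + (\<Sum>l<N. half_moment 0 (2 * l + 2) * ?x (2 * l)))"
    using bc[unfolded linearized_wall_bc_def, rule_format, of 0 0 0] f2 unfolding rhs by simp
  \<comment> \<open>Solving for the product \<open>bcoef chi * h 0\<close> instead of
    \<open>h 0\<close> covers \<open>chi = 0\<close>, where \<open>bcoef chi\<close>
    vanishes.\<close>
  then have h0: "bcoef chi * h 0 = bcoef chi * (\<Sum>l<N. half_moment 0 (2 * l + 2) * ?x (2 * l))"
    by (simp add: half_moment_0_0 algebra_simps)
  have "fact (2 * k + 2) * (f (0, 2 * k + 1, 0) + (2 * real k + 3) * f (0, 2 * k + 3, 0))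
      = bcoef chi * (half_moment (2 * k + 2) 0 * h 0
          + (\<Sum>l<N. half_moment (2 * k + 2) (2 * l + 2) * ?x (2 * l)))"
    using bc[unfolded linearized_wall_bc_def, rule_format, of 0 "2 * k + 2" 0] k unfolding rhs
    by (simp add: numeral_3_eq_3 add_ac)
  also have "\<dots> = half_moment (2 * k + 2) 0 * (bcoef chi * h 0)
      + bcoef chi * (\<Sum>l<N. half_moment (2 * k + 2) (2 * l + 2) * ?x (2 * l))"
    by (simp add: algebra_simps)
  also have "\<dots> = bcoef chi * Tb_wall_jump M f (\<theta> - \<theta>W) (2 * k)"
    unfolding h0 Tb_wall_jump_even[OF M] N_def[symmetric]
    by (simp add: half_moment_0_0 algebra_simps sum.distrib sum_distrib_left)
  finally show ?thesis .
qed

text \<open>The sum of the conditions for \<alpha> = 2 e_1 + 2k e_2 and \<alpha> = 2 e_3 + 2k e_2.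
  Their two wall moments (\<theta>W - \<theta>) / 2 add up to a full temperature jump, and the
  density does not enter.\<close>

lemma wall_bc_gbar:
  assumes M: "3 \<le> M"
    and bc: "linearized_wall_bc M chi f u \<theta> \<rho>W uW \<theta>W"
    and k: "2 * k + 2 \<le> M - 1"
  shows "fact (2 * k) * ((if k = 0 then 0 else gbar f (2 * k - 1)) + (2 * real k + 1) * gbar f (2 * k + 1))
    = bcoef chi * Tb_wall_jump M f (\<theta> - \<theta>W) (2 * k + 1)"
proof -
  let ?x = "wall_jump f (\<theta> - \<theta>W)"
  define N where "N = M div 2"
  define hx where "hx \<beta> = f (2, \<beta>, 0) - wall_moment \<rho>W uW u \<theta>W \<theta> (2, \<beta>, 0)" for \<beta>
  define hz where "hz \<beta> = f (0, \<beta>, 2) - wall_moment \<rho>W uW u \<theta>W \<theta> (0, \<beta>, 2)" for \<beta>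
  have h: "hx (2 * l) + hz (2 * l) = ?x (2 * l + 1)" for l
    by (auto simp: hx_def hz_def wall_jump_def wall_moment_def gbar_def field_simps)
  \<comment> \<open>Two orders are used up in direction 1 or 3, so \<beta> stops at
    \<open>M - 2\<close>. This leaves \<open>M div 2\<close> terms, one fewer than along direction
    2.\<close>
  have N: "{..(M - 2) div 2} = {..<N}"
    using M by (auto simp: N_def)
  have "fact (2 * k) * ((if k = 0 then 0 else f (2, 2 * k - 1, 0)) + (2 * real k + 1) * f (2, 2 * k + 1, 0))
      = bcoef chi * (\<Sum>l<N. half_moment (2 * k) (2 * l) * hx (2 * l))"
    using bc[unfolded linearized_wall_bc_def, rule_format, of 2 "2 * k" 0] k N
    unfolding sum_even_le by (simp add: hx_def add_ac)
  moreover have "fact (2 * k) * ((if k = 0 then 0 else f (0, 2 * k - 1, 2)) + (2 * real k + 1) * f (0, 2 * k + 1, 2))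
      = bcoef chi * (\<Sum>l<N. half_moment (2 * k) (2 * l) * hz (2 * l))"
    using bc[unfolded linearized_wall_bc_def, rule_format, of 0 "2 * k" 2] k N
    unfolding sum_even_le by (simp add: hz_def add_ac)
  ultimately have "fact (2 * k) * ((if k = 0 then 0 else gbar f (2 * k - 1)) + (2 * real k + 1) * gbar f (2 * k + 1))
      = bcoef chi * (\<Sum>l<N. half_moment (2 * k) (2 * l) * hx (2 * l))
        + bcoef chi * (\<Sum>l<N. half_moment (2 * k) (2 * l) * hz (2 * l))"
    by (auto simp: gbar_def algebra_simps)
  also have "\<dots> = bcoef chi * (\<Sum>l<N. half_moment (2 * k) (2 * l) * (hx (2 * l) + hz (2 * l)))"
    by (simp add: algebra_simps sum.distrib)
  finally show ?thesis
    unfolding h Tb_wall_jump_odd[OF M] N_def .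
qed

section \<open>Row-by-row comparison of the two sides\<close>

lemma M0_mult_vec:
  "M0 M *\<^sub>v w_odd M f
    = vec (m_even M) (\<lambda>i. (\<Sum>j = 1..m_odd M. coupling (i + 1) j * f_odd_entry f j) / a_norm (i + 1))"
proof (rule eq_vecI)
  have b: "b_norm j \<noteq> 0" for j
    using b_norm_pos[of j] by simp
  have w: "w_odd M f = vec (m_odd M) (\<lambda>j. b_norm (j + 1) * f_odd_entry f (j + 1))"
    unfolding w_odd_def L2_def f_odd_def by (rule eq_vecI) (simp_all add: mat_diag_mult_vec)
  fix i assume "i < dim_vec (vec (m_even M)
    (\<lambda>i. (\<Sum>j = 1..m_odd M. coupling (i + 1) j * f_odd_entry f j) / a_norm (i + 1)))"
  then have i: "i < m_even M" by simp
  have "(M0 M *\<^sub>v w_odd M f) $ i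
      = (\<Sum>j<m_odd M. m0_entry (i + 1) (j + 1) * (b_norm (j + 1) * f_odd_entry f (j + 1)))"
    using i by (simp add: M0_def w scalar_prod_def lessThan_atLeast0)
  also have "\<dots> = (\<Sum>j<m_odd M. coupling (i + 1) (j + 1) * f_odd_entry f (j + 1) / a_norm (i + 1))"
    by (rule sum.cong) (simp_all add: m0_entry_def coupling_def b)
  also have "\<dots> = (\<Sum>j = 1..m_odd M. coupling (i + 1) j * f_odd_entry f j) / a_norm (i + 1)"
    by (simp add: sum.atLeast1_atMost_eq sum_divide_distrib)
  finally show "(M0 M *\<^sub>v w_odd M f) $ i = vec (m_even M)
    (\<lambda>i. (\<Sum>j = 1..m_odd M. coupling (i + 1) j * f_odd_entry f j) / a_norm (i + 1)) $ i"
    using i by simp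
qed (simp add: M0_def)

text \<open>Here and in the next two lemmas the norms clear the square roots: what remains are the
  multiples 4/5, 24/5 and 4/5 of the heat flux that rows 1 to 3 have to absorb.\<close>

lemma c_r_1: "m_odd M \<ge> 1 \<Longrightarrow> c_r M $ 1 * a_norm 1 = 4 / 5"
  by (simp add: c_r_def a_norm_def weighted_inner_phi_even)

lemma c_r_even:
  assumes "k \<ge> 1" "2 * k \<le> m_odd M"
  shows "c_r M $ (2 * k) * a_norm (2 * k) = (if k = 1 then 24 / 5 else 0)"
proof -
  have "sqrt 24 = 2 * sqrt 6"
    using real_sqrt_mult[of 4 6] by simp
  then show ?thesis
    using assms by (auto simp: c_r_def a_norm_def weighted_inner_phi_even fact_numeral)
qed

lemma c_r_odd:
  assumes "k \<ge> 1" "2 * k + 1 \<le> m_odd M"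
  shows "c_r M $ (2 * k + 1) * a_norm (2 * k + 1) = (if k = 1 then 4 / 5 else 0)"
  using assms by (auto simp: c_r_def a_norm_def weighted_inner_phi_even fact_numeral)

lemma wall_bc_row:
  fixes \<theta> \<theta>W :: real
  assumes M: "3 \<le> M" and f2: "f (0, 1, 0) = 0"
    and bc: "linearized_wall_bc M chi f u \<theta> \<rho>W uW \<theta>W"
    and i: "1 \<le> i" "i \<le> m_odd M"
  defines "y \<equiv> Tb_wall_jump M f (\<theta> - \<theta>W)"
  shows "heat_flux2 f * c_r M $ i + (\<Sum>j = 1..m_odd M. coupling i j * f_odd_entry f j) / a_norm i
    = bcoef chi * (if i = 1 then y 0 - y 1 else y i) / a_norm i"
proof -
  have q: "heat_flux2 f = 3 * f (0, 3, 0) + gbar f 1"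
    by (simp add: heat_flux2_def gbar_def)
  \<comment> \<open>Rows up to \<open>m_odd M\<close> need only multi-indices of order at most
    \<open>M - 1\<close>, for which wall conditions are imposed.\<close>
  have bound: "2 * k + 2 \<le> M - 1" if "2 * k \<le> m_odd M" for k
    using that M by (simp add: m_odd_def; presburger)
  have "heat_flux2 f * (c_r M $ i * a_norm i) + (\<Sum>j = 1..m_odd M. coupling i j * f_odd_entry f j)
    = bcoef chi * (if i = 1 then y 0 - y 1 else y i)"
  proof (cases "even i")
    case True
    then obtain k where k: "i = 2 * k" by blast
    with i have k1: "k \<ge> 1" by simp
    define p where "p = (if k = 1 then 1 else 2 * k - 2)"
    have p: "1 \<le> p" "p \<le> m_odd M"
      using i k k1 by (auto simp: p_def)
    have "(\<Sum>j = 1..m_odd M. coupling i j * f_odd_entry f j)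
        = (\<Sum>j = 1..m_odd M. (if j = 2 * k then (2 * real k + 3) * fact (2 * k + 2) * f_odd_entry f (2 * k) else 0)
            + (if j = p then fact (2 * k + 2) * f_odd_entry f p else 0))"
      unfolding k using k1 by (intro sum.cong) (auto simp: coupling_even[OF k1, folded p_def] distrib_right)
    also have "\<dots> = (2 * real k + 3) * fact (2 * k + 2) * f_odd_entry f (2 * k)
        + fact (2 * k + 2) * f_odd_entry f p"
      using i k k1 p by (simp add: sum.distrib)
    finally have s: "(\<Sum>j = 1..m_odd M. coupling i j * f_odd_entry f j) = \<dots>" .
    have "bcoef chi * y (2 * k)
        = fact (2 * k + 2) * (f (0, 2 * k + 1, 0) + (2 * real k + 3) * f (0, 2 * k + 3, 0))"
      using wall_bc_tbar[OF M f2 bc bound[of k]] i k by (simp add: y_def)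
    moreover have "f_odd_entry f (2 * k) = f (0, 2 * k + 3, 0)"
      by (simp add: f_odd_entry_def tbar_def numeral_3_eq_3)
    moreover have "f_odd_entry f p = f (0, 2 * k + 1, 0) - (if k = 1 then heat_flux2 f / 5 else 0)"
      using k1 by (auto simp: p_def f_odd_entry_def tbar_def numeral_3_eq_3 intro!: arg_cong[of _ _ f])
    \<comment> \<open>For \<open>k = 1\<close> the leftover - 4! / 5 times the heat flux cancels
      against the entry 24/5 from \<open>c_r\<close>.\<close>
    ultimately show ?thesis
      using k1 i c_r_even[OF k1, of M] unfolding s
      by (auto simp: k algebra_simps fact_numeral)
  next
    case False
    then obtain k where k: "i = 2 * k + 1" by (rule oddE)
    show ?thesis
    proof (cases "k = 0")
      case True
      have "(\<Sum>j = 1..m_odd M. coupling i j * f_odd_entry f j)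
          = (\<Sum>j = 1..m_odd M. if j = 1 then 9 * f_odd_entry f 1 else 0)"
        unfolding k True by (intro sum.cong) (auto simp: coupling_1[simplified])
      also have "\<dots> = 9 * f_odd_entry f 1"
        using i by simp
      finally have s: "(\<Sum>j = 1..m_odd M. coupling i j * f_odd_entry f j) = \<dots>" .
      have "bcoef chi * y 0 = 6 * f (0, 3, 0)" "bcoef chi * y 1 = gbar f 1"
        using wall_bc_tbar[OF M f2 bc, of 0] wall_bc_gbar[OF M bc, of 0] M f2
        by (simp_all add: y_def)
      moreover have c: "c_r M $ i * a_norm i = 4 / 5"
        using c_r_1[of M] i k True by simp
      \<comment> \<open>With t = \<open>f (0, 3, 0)\<close>, g = \<open>gbar f 1\<close> and q = 3 t
        + g the heat flux, 9 (t - q/5) + (4/5) q = 9 t - q = 6 t - g.\<close>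
      ultimately show ?thesis
        unfolding s c by (simp add: k True q f_odd_entry_def tbar_def field_simps numeral_3_eq_3)
    next
      case k0: False
      then have k1: "k \<ge> 1" by simp
      have prev: "1 \<le> 2 * k - 1" "2 * k - 1 \<le> m_odd M"
        using i k k1 by simp_all
      let ?c = "if k = 1 then - 6 else fact (2 * k) :: real"
      have "(\<Sum>j = 1..m_odd M. coupling i j * f_odd_entry f j)
          = (\<Sum>j = 1..m_odd M. (if j = 2 * k + 1 then fact (2 * k + 1) * f_odd_entry f (2 * k + 1) else 0)
              + (if j = 2 * k - 1 then ?c * f_odd_entry f (2 * k - 1) else 0))"
        unfolding k using k1 by (intro sum.cong) (auto simp: coupling_odd[simplified])
      also have "\<dots> = fact (2 * k + 1) * f_odd_entry f (2 * k + 1) + ?c * f_odd_entry f (2 * k - 1)"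
        using i k prev by (simp add: sum.distrib)
      finally have s: "(\<Sum>j = 1..m_odd M. coupling i j * f_odd_entry f j) = \<dots>" .
      have y: "bcoef chi * y (2 * k + 1) = fact (2 * k) * (gbar f (2 * k - 1) + (2 * real k + 1) * gbar f (2 * k + 1))"
        using wall_bc_gbar[OF M bc bound[of k]] i k k1 by (simp add: y_def)
      have o: "f_odd_entry f (2 * k + 1) = gbar f (2 * k + 1)"
        using k1 by (simp add: f_odd_entry_def)
      have p: "f_odd_entry f (2 * k - 1) = (if k = 1 then f (0, 3, 0) - heat_flux2 f / 5 else gbar f (2 * k - 1))"
        using k1 by (auto simp: f_odd_entry_def tbar_def numeral_3_eq_3)
      \<comment> \<open>For \<open>k = 1\<close>, with t = \<open>f (0, 3, 0)\<close>, g =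
        \<open>gbar f 1\<close> and heat flux q = 3 t + g, the exceptional coefficient gives - 6 (t
        - q/5) + (4/5) q = 2 q - 6 t = 2 g, the term 2! * g of the wall condition.\<close>
      show ?thesis
        using k1 i y c_r_odd[OF k1, of M] unfolding s o p
        by (auto simp: k q field_simps fact_numeral)
    qed
  qed
  then show ?thesis
    using a_norm_pos[of i] by (simp add: field_simps)
qed

section \<open>Boundary conditions for the characteristic variables\<close>

theorem theorem3p2:
  fixes M :: nat and chi :: real
    and f :: "nat \<times> nat \<times> nat \<Rightarrow> real"
    and u uW :: "nat \<Rightarrow> real"
    and \<theta> \<theta>W \<rho>W :: real
    and Reven R0 Rodd \<Lambda>p :: "real mat"
    and v_plus v_zero v_minus :: "real vec"
  assumes M: "3 \<le> M"
    and chi_range: "0 \<le> chi" "chi \<le> 1"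
    and f_first: "f (1, 0, 0) = 0" "f (0, 1, 0) = 0" "f (0, 0, 1) = 0"
    and f_trace: "f (2, 0, 0) + f (0, 2, 0) + f (0, 0, 2) = 0"
    and u2: "u 2 = 0" and uW2: "uW 2 = 0"
    and wall_bc: "linearized_wall_bc M chi f u \<theta> \<rho>W uW \<theta>W"
    and diagonalization: "orthogonal_diagonalization M Reven R0 Rodd \<Lambda>p"
    and v_dims: "v_plus \<in> carrier_vec (m_odd M)"
      "v_zero \<in> carrier_vec (m_even M - m_odd M)"
      "v_minus \<in> carrier_vec (m_odd M)"
    and v_def: "v_plus @\<^sub>v v_zero @\<^sub>v v_minus =
      mat_inv (eigvec_mat M Reven R0 Rodd) *\<^sub>v (w_even M f @\<^sub>v w_odd M f)"
    and v_minus: "v_minus = 0\<^sub>v (m_odd M)"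
    and v_zero: "v_zero = 0\<^sub>v (m_even M - m_odd M)"
  shows "w_even M f = Reven *\<^sub>v v_plus
    \<and> w_odd M f = Rodd *\<^sub>v v_plus
    \<and> heat_flux2 f \<cdot>\<^sub>v c_r M
           + E_mat M *\<^sub>v (diag_block_mat [0\<^sub>m 1 1, M0 M] *\<^sub>v vCons (\<theta> - \<theta>W) (w_odd M f))
         = bcoef chi \<cdot>\<^sub>v (E_mat M *\<^sub>v (T_mat M *\<^sub>v vCons (\<theta> - \<theta>W) (w_even M f)))"
proof (intro conjI)
  let ?R = "eigvec_mat M Reven R0 Rodd"
  let ?n = "m_even M + m_odd M"
  have R: "Reven \<in> carrier_mat (m_even M) (m_odd M)"
    "R0 \<in> carrier_mat (m_even M) (m_even M - m_odd M)" "Rodd \<in> carrier_mat (m_odd M) (m_odd M)"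
    and ortho: "inverts_mat ?R (transpose_mat ?R)" "inverts_mat (transpose_mat ?R) ?R"
    using diagonalization by (simp_all add: orthogonal_diagonalization_def Let_def)
  have eigvec: "?R \<in> carrier_mat ?n ?n"
    using eigvec_mat_carrier[OF R] m_odd_le_m_even[of M] by (simp add: add.commute)
  have transp: "?R * transpose_mat ?R = 1\<^sub>m ?n" "transpose_mat ?R * ?R = 1\<^sub>m ?n"
    using ortho eigvec by (simp_all add: inverts_mat_def)
  have w: "w_even M f \<in> carrier_vec (m_even M)" "w_odd M f \<in> carrier_vec (m_odd M)"
    by (simp_all add: w_even_def w_odd_def L1_def L2_def f_even_def f_odd_def mat_diag_mult_vec)
  \<comment> \<open>The inverse of the orthogonal matrix is its transpose, so applying
    \<open>?R\<close> to the characteristic variables recovers \<open>w_even\<close> and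
    \<open>w_odd\<close>.\<close>
  have "?R *\<^sub>v (v_plus @\<^sub>v v_zero @\<^sub>v v_minus)
      = ?R *\<^sub>v (transpose_mat ?R *\<^sub>v (w_even M f @\<^sub>v w_odd M f))"
    unfolding v_def using mat_inv_eqI[OF eigvec _ transp] eigvec by simp
  also have "\<dots> = ?R * transpose_mat ?R *\<^sub>v (w_even M f @\<^sub>v w_odd M f)"
    by (rule assoc_mult_mat_vec[symmetric]) (use eigvec w in auto)
  also have "\<dots> = w_even M f @\<^sub>v w_odd M f"
    unfolding transp by (rule one_mult_mat_vec) (use w in simp)
  finally have "(Reven *\<^sub>v v_plus) @\<^sub>v (Rodd *\<^sub>v v_plus) = w_even M f @\<^sub>v w_odd M f"
    unfolding v_minus v_zero eigvec_mat_mult_vec[OF R v_dims(1)] .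
  moreover have "Reven *\<^sub>v v_plus \<in> carrier_vec (m_even M)"
    using R v_dims by simp
  ultimately show "w_even M f = Reven *\<^sub>v v_plus" "w_odd M f = Rodd *\<^sub>v v_plus"
    using w by simp_all
  let ?y = "Tb_wall_jump M f (\<theta> - \<theta>W)"
  have M0w: "M0 M *\<^sub>v w_odd M f \<in> carrier_vec (m_even M)"
    unfolding M0_mult_vec by simp
  have "diag_block_mat [0\<^sub>m 1 1, M0 M] *\<^sub>v vCons (\<theta> - \<theta>W) (w_odd M f) = vCons 0 (M0 M *\<^sub>v w_odd M f)"
    using diag_block_mat_mult_vCons[of "0\<^sub>m 1 1" "M0 M" "m_even M" "m_odd M" "w_odd M f"] w
    by (simp add: M0_def del: diag_block_mat.simps)
  moreover have "E_mat M *\<^sub>v vCons 0 (M0 M *\<^sub>v w_odd M f)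
      = vec (m_odd M + 1) (\<lambda>i. vCons 0 (M0 M *\<^sub>v w_odd M f) $ i)"
    by (rule E_mat_mult_vec) (use M0w in simp)
  moreover have "E_mat M *\<^sub>v (T_mat M *\<^sub>v vCons (\<theta> - \<theta>W) (w_even M f)) = vec (m_odd M + 1)
      (\<lambda>i. if i = 0 then ?y 0 / 2 + ?y 1 else if i = 1 then (?y 0 - ?y 1) / a_norm 1 else ?y i / a_norm i)"
    unfolding T_mat_mult_vec[OF M f_trace] using m_odd_le_m_even[of M]
    by (subst E_mat_mult_vec) (auto intro!: eq_vecI)
  moreover have "heat_flux2 f \<cdot>\<^sub>v c_r M + vec (m_odd M + 1) (\<lambda>i. vCons 0 (M0 M *\<^sub>v w_odd M f) $ i)
      = bcoef chi \<cdot>\<^sub>v vec (m_odd M + 1)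
      (\<lambda>i. if i = 0 then ?y 0 / 2 + ?y 1 else if i = 1 then (?y 0 - ?y 1) / a_norm 1 else ?y i / a_norm i)"
    (is "?l = ?r")
  proof (rule eq_vecI)
    fix i assume "i < dim_vec ?r"
    then have i: "i \<le> m_odd M" by simp
    show "?l $ i = ?r $ i"
    proof (cases "i = 0")
      case True
      \<comment> \<open>In row 0 the block with \<open>M0\<close> contributes 0, and half of the
        first value plus the second, \<open>3 * f (0, 3, 0) + gbar f 1\<close>, is the heat flux
        itself.\<close>
      have "bcoef chi * ?y 0 = 6 * f (0, 3, 0)" "bcoef chi * ?y 1 = gbar f 1"
        using wall_bc_tbar[OF M f_first(2) wall_bc, of 0] wall_bc_gbar[OF M wall_bc, of 0] M f_first
        by simp_all
      then show ?thesis
        by (simp add: True c_r_def heat_flux2_def gbar_def algebra_simps)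
    next
      case False
      \<comment> \<open>Position \<open>i\<close> behind the leading 0 is the 0-based entry
        \<open>i - 1\<close> of the product, hence the 1-based row \<open>i\<close>.\<close>
      then have "vCons 0 (M0 M *\<^sub>v w_odd M f) $ i
          = (\<Sum>j = 1..m_odd M. coupling i j * f_odd_entry f j) / a_norm i"
        using i m_odd_le_m_even[of M] by (cases i) (simp_all add: vec_index_vCons M0_mult_vec)
      then show ?thesis
        using wall_bc_row[OF M f_first(2) wall_bc, of i] False i
        by (auto simp: c_r_def)
    qed
  qed (simp add: c_r_def)
  ultimately show "heat_flux2 f \<cdot>\<^sub>v c_r M
           + E_mat M *\<^sub>v (diag_block_mat [0\<^sub>m 1 1, M0 M] *\<^sub>v vCons (\<theta> - \<theta>W) (w_odd M f))
         = bcoef chi \<cdot>\<^sub>v (E_mat M *\<^sub>v (T_mat M *\<^sub>v vCons (\<theta> - \<theta>W) (w_even M f)))"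
    by (simp only:)
qed

end
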